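(* Let $T_0$ be a closed, symmetric (densely defined) operator in a complex Hilbert space $H$ with equal, finite deficiency indices $\mathrm{def}(T_0)\ge1$, and let $T_1=T_0^*$ (so $T_1^*=T_0$). Let $W$ be a finite-dimensional complex inner product space with $\dim W\le\mathrm{def}(T_0)$, with orthonormal basis $\{\xi_j\mid j=1,\ldots,\dim W\}$, let $\{t_j\mid j=1,\ldots,\dim W\}\subseteq\mathcal D(T_1)$ be a partial GKN set for $T_0$, and let $B:W\to W$ be self-adjoint. Let $\widehat T_0$ be the operator in $H\oplus W$ with $\mathcal D(\widehat T_0)=\{(x,\Psi x)\mid x\in\Delta_0\}$, $\widehat T_0(x,a)=(T_1x,Ba)$, and let $\widehat T_1$ be the operator in $H\oplus W$ with $\mathcal D(\widehat T_1)=\{(x,a)\mid x\in\mathcal D(T_1),\ a\in W\}$, $\widehat T_1(x,a)=(T_1x,\,Ba-\Omega x)$. Then $$\widehat T_0=\overline{\widehat T_0}\subseteq(\widehat T_0)^*=\widehat T_1,$$ where $\overline{\widehat T_0}$ denotes the closure of $\widehat T_0$.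
   Context: $\mathrm{def}(T_0)$ is the common value of $\dim\{x\in\mathcal D(T_1)\mid T_1x=\pm ix\}$. $[x,y]_H:=\langle T_1x,y\rangle_H-\langle x,T_1y\rangle_H$ for $x,y\in\mathcal D(T_1)$ (inner products linear in the first argument). A partial GKN set here is a set $\{t_j\mid j=1,\ldots,\dim W\}\subseteq\mathcal D(T_1)$ such that $\sum_j\alpha_jt_j\in\mathcal D(T_0)$ implies all $\alpha_j=0$, and $[t_i,t_j]_H=0$ for all $i,j$. $\Delta_0:=\mathcal D(T_0)+\mathrm{span}\{t_j\mid j=1,\ldots,\dim W\}$; $\Psi:\Delta_0\to W$ is the linear map $\Psi\big(s+\sum_j\alpha_jt_j\big)=\sum_j\alpha_j\xi_j$ for $s\in\mathcal D(T_0)$, $\alpha_j\in\mathbb C$; $\Omega:\mathcal D(T_1)\to W$ is the linear map $\Omega x=\sum_{j=1}^{\dim W}[x,t_j]_H\,\xi_j$. $H\oplus W$ is the Hilbert space of pairs $(x,a)$, $x\in H$, $a\in W$, with $\langle (x,a),(y,b)\rangle_{H\oplus W}=\langle x,y\rangle_H+\langle a,b\rangle_W$. *)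

theory Defs
  imports "HOL-Analysis.Analysis"
begin

section \<open>Complex inner product spaces\<close>

class complex_vector = real_vector +
  fixes scaleC :: "complex \<Rightarrow> 'a \<Rightarrow> 'a"  (infixr \<open>*\<^sub>C\<close> 75)
  assumes scaleC_add_right: "a *\<^sub>C (x + y) = a *\<^sub>C x + a *\<^sub>C y"
    and scaleC_add_left: "(a + b) *\<^sub>C x = a *\<^sub>C x + b *\<^sub>C x"
    and scaleC_scaleC: "a *\<^sub>C b *\<^sub>C x = (a * b) *\<^sub>C x"
    and scaleC_one: "1 *\<^sub>C x = x"
    and scaleR_scaleC: "r *\<^sub>R x = complex_of_real r *\<^sub>C x"

global_interpretation complex_vector: vector_space "scaleC :: complex \<Rightarrow> 'a::complex_vector \<Rightarrow> 'a"
  by unfold_locales (simp_all add: scaleC_add_right scaleC_add_left scaleC_scaleC scaleC_one)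

text \<open>The complex inner product is linear in the first argument. Its real part is the
  \<^const>\<open>inner\<close> of the underlying real inner product space; this yields positive definiteness and
  \<open>norm x = sqrt (Re (cinner x x))\<close>, so that the topology is that of the complex inner product.\<close>

class complex_inner = complex_vector + real_inner +
  fixes cinner :: "'a \<Rightarrow> 'a \<Rightarrow> complex"
  assumes cinner_commute: "cinner x y = cnj (cinner y x)"
    and cinner_add_left: "cinner (x + y) z = cinner x z + cinner y z"
    and cinner_scaleC_left: "cinner (a *\<^sub>C x) y = a * cinner x y"
    and inner_eq_Re_cinner: "inner x y = Re (cinner x y)"

class complex_hilbert = complex_inner + complete_space

instantiation prod :: (complex_vector, complex_vector) complex_vector
begin

definition scaleC_prod_def: "a *\<^sub>C p = (a *\<^sub>C fst p, a *\<^sub>C snd p)"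

instance
  by standard
    (simp_all add: scaleC_prod_def scaleC_add_right scaleC_add_left scaleC_scaleC scaleC_one
      scaleR_prod_def scaleR_scaleC)

end

instantiation prod :: (complex_inner, complex_inner) complex_inner
begin

definition cinner_prod_def: "cinner p q = cinner (fst p) (fst q) + cinner (snd p) (snd q)"

instance
proof
  fix p q r :: "'a \<times> 'b" and a :: complex
  show "cinner p q = cnj (cinner q p)"
    by (simp add: cinner_prod_def cinner_commute[of "fst p"] cinner_commute[of "snd p"])
  show "cinner (p + q) r = cinner p r + cinner q r"
    by (simp add: cinner_prod_def cinner_add_left)
  show "cinner (a *\<^sub>C p) q = a * cinner p q"
    by (simp add: cinner_prod_def scaleC_prod_def cinner_scaleC_left algebra_simps)
  show "inner p q = Re (cinner p q)"
    by (simp add: cinner_prod_def inner_prod_def inner_eq_Re_cinner)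
qed

end

instance prod :: (complex_hilbert, complex_hilbert) complex_hilbert ..

definition finite_cdim :: "'a::complex_vector set \<Rightarrow> bool" where
  "finite_cdim S \<longleftrightarrow> (\<exists>A. finite A \<and> complex_vector.span A = S)"

definition orthonormal_basis :: "nat \<Rightarrow> (nat \<Rightarrow> 'w::complex_inner) \<Rightarrow> bool" where
  "orthonormal_basis n \<xi> \<longleftrightarrow>
     (\<forall>i\<in>{1..n}. \<forall>j\<in>{1..n}. cinner (\<xi> i) (\<xi> j) = (if i = j then 1 else 0)) \<and>
     complex_vector.span (\<xi> ` {1..n}) = UNIV"

definition selfadjoint_map :: "('w::complex_inner \<Rightarrow> 'w) \<Rightarrow> bool" where
  "selfadjoint_map B \<longleftrightarrow>
     Vector_Spaces.linear scaleC scaleC B \<and> (\<forall>a b. cinner (B a) b = cinner a (B b))"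


section \<open>Unbounded operators\<close>

text \<open>A possibly unbounded operator in \<open>'a\<close> is identified with its graph, a subset of
  \<open>'a \<times> 'a\<close>; its domain is \<^const>\<open>Domain\<close>. Equality of operators is thus equality of graphs,
  extension is \<open>\<subseteq>\<close>, and the closure of an operator is the topological \<^const>\<open>closure\<close> of its graph.\<close>

definition linear_operator :: "('a::complex_vector \<times> 'a) set \<Rightarrow> bool" where
  "linear_operator T \<longleftrightarrow> complex_vector.subspace T \<and> single_valued T"

definition op_app :: "('a \<times> 'a) set \<Rightarrow> 'a \<Rightarrow> 'a"  (infixr \<open>\<bullet>\<^sub>o\<close> 90) where
  "T \<bullet>\<^sub>o x = (THE y. (x, y) \<in> T)"

definition op_on :: "'a set \<Rightarrow> ('a \<Rightarrow> 'a) \<Rightarrow> ('a \<times> 'a) set" where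
  "op_on D f = {(x, f x) | x. x \<in> D}"

definition densely_defined :: "('a::topological_space \<times> 'a) set \<Rightarrow> bool" where
  "densely_defined T \<longleftrightarrow> closure (Domain T) = UNIV"

definition symmetric_operator :: "('a::complex_inner \<times> 'a) set \<Rightarrow> bool" where
  "symmetric_operator T \<longleftrightarrow> linear_operator T \<and> densely_defined T \<and>
     (\<forall>x\<in>Domain T. \<forall>y\<in>Domain T. cinner (T \<bullet>\<^sub>o x) y = cinner x (T \<bullet>\<^sub>o y))"

text \<open>\<open>(y, z)\<close> is in the adjoint iff \<open>\<langle>T x, y\<rangle> = \<langle>x, z\<rangle>\<close> for all \<open>x\<close> in the domain of \<open>T\<close>.
  This is the graph of an operator exactly when \<open>T\<close> is densely defined (in a Hilbert space).
  The equation of an adjoint with a single-valued graph therefore includes that density.\<close>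

definition op_adjoint :: "('a::complex_inner \<times> 'a) set \<Rightarrow> ('a \<times> 'a) set" where
  "op_adjoint T = {(y, z). \<forall>(x, w)\<in>T. cinner w y = cinner x z}"

definition eigenspace :: "('a::complex_vector \<times> 'a) set \<Rightarrow> complex \<Rightarrow> 'a set" where
  "eigenspace T c = {x \<in> Domain T. T \<bullet>\<^sub>o x = c *\<^sub>C x}"

text \<open>Finiteness is required explicitly: \<open>complex_vector.dim\<close> is \<open>0\<close> on
  infinite-dimensional spaces.\<close>

definition equal_finite_deficiency :: "('a::complex_inner \<times> 'a) set \<Rightarrow> nat \<Rightarrow> bool" where
  "equal_finite_deficiency T d \<longleftrightarrow>
     (\<forall>c\<in>{\<i>, - \<i>}. finite_cdim (eigenspace (op_adjoint T) c) \<and>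
                  complex_vector.dim (eigenspace (op_adjoint T) c) = d)"


section \<open>Partial GKN sets and the extended operators\<close>

definition symp :: "('h::complex_inner \<times> 'h) set \<Rightarrow> 'h \<Rightarrow> 'h \<Rightarrow> complex" where
  "symp T1 x y = cinner (T1 \<bullet>\<^sub>o x) y - cinner x (T1 \<bullet>\<^sub>o y)"

definition partial_GKN ::
    "('h::complex_inner \<times> 'h) set \<Rightarrow> ('h \<times> 'h) set \<Rightarrow> nat \<Rightarrow> (nat \<Rightarrow> 'h) \<Rightarrow> bool" where
  "partial_GKN T0 T1 n t \<longleftrightarrow>
     (\<forall>j\<in>{1..n}. t j \<in> Domain T1) \<and>
     (\<forall>\<alpha>. (\<Sum>j=1..n. \<alpha> j *\<^sub>C t j) \<in> Domain T0 \<longrightarrow> (\<forall>j\<in>{1..n}. \<alpha> j = 0)) \<and>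
     (\<forall>i\<in>{1..n}. \<forall>j\<in>{1..n}. symp T1 (t i) (t j) = 0)"

definition \<Delta>\<^sub>0 :: "('h::complex_vector \<times> 'h) set \<Rightarrow> nat \<Rightarrow> (nat \<Rightarrow> 'h) \<Rightarrow> 'h set" where
  "\<Delta>\<^sub>0 T0 n t = {s + u | s u. s \<in> Domain T0 \<and> u \<in> complex_vector.span (t ` {1..n})}"

text \<open>\<open>\<Psi>\<close> is only meaningful on \<open>\<Delta>\<^sub>0\<close>, for a partial GKN set \<open>t\<close>;
  see \<open>\<Psi>_eq\<close> below for its well-definedness.\<close>

definition \<Psi> :: "('h::complex_vector \<times> 'h) set \<Rightarrow> nat \<Rightarrow> (nat \<Rightarrow> 'h) \<Rightarrow>
    (nat \<Rightarrow> 'w::complex_vector) \<Rightarrow> 'h \<Rightarrow> 'w" where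
  "\<Psi> T0 n t \<xi> x = (THE w. \<exists>s \<alpha>. s \<in> Domain T0 \<and>
     x = s + (\<Sum>j=1..n. \<alpha> j *\<^sub>C t j) \<and> w = (\<Sum>j=1..n. \<alpha> j *\<^sub>C \<xi> j))"

definition \<Omega> :: "('h::complex_inner \<times> 'h) set \<Rightarrow> nat \<Rightarrow> (nat \<Rightarrow> 'h) \<Rightarrow>
    (nat \<Rightarrow> 'w::complex_vector) \<Rightarrow> 'h \<Rightarrow> 'w" where
  "\<Omega> T1 n t \<xi> x = (\<Sum>j=1..n. symp T1 x (t j) *\<^sub>C \<xi> j)"

definition That0 :: "('h::complex_inner \<times> 'h) set \<Rightarrow> ('h \<times> 'h) set \<Rightarrow> nat \<Rightarrow> (nat \<Rightarrow> 'h) \<Rightarrow>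
    (nat \<Rightarrow> 'w::complex_inner) \<Rightarrow> ('w \<Rightarrow> 'w) \<Rightarrow> (('h \<times> 'w) \<times> ('h \<times> 'w)) set" where
  "That0 T0 T1 n t \<xi> B =
     op_on {(x, \<Psi> T0 n t \<xi> x) | x. x \<in> \<Delta>\<^sub>0 T0 n t} (\<lambda>(x, a). (T1 \<bullet>\<^sub>o x, B a))"

definition That1 :: "('h::complex_inner \<times> 'h) set \<Rightarrow> nat \<Rightarrow> (nat \<Rightarrow> 'h) \<Rightarrow>
    (nat \<Rightarrow> 'w::complex_inner) \<Rightarrow> ('w \<Rightarrow> 'w) \<Rightarrow> (('h \<times> 'w) \<times> ('h \<times> 'w)) set" where
  "That1 T1 n t \<xi> B =
     op_on (Domain T1 \<times> UNIV) (\<lambda>(x, a). (T1 \<bullet>\<^sub>o x, B a - \<Omega> T1 n t \<xi> x))"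

lemma \<Psi>_eq:
  fixes \<xi> :: "nat \<Rightarrow> 'w::complex_vector"
  assumes T0: "linear_operator T0" and t: "partial_GKN T0 T1 n t" and s: "s \<in> Domain T0"
  shows "\<Psi> T0 n t \<xi> (s + (\<Sum>j=1..n. \<alpha> j *\<^sub>C t j)) = (\<Sum>j=1..n. \<alpha> j *\<^sub>C \<xi> j)"
  unfolding \<Psi>_def
proof (rule the_equality)
  show "\<exists>s' \<alpha>'. s' \<in> Domain T0 \<and>
      s + (\<Sum>j=1..n. \<alpha> j *\<^sub>C t j) = s' + (\<Sum>j=1..n. \<alpha>' j *\<^sub>C t j) \<and>
      (\<Sum>j=1..n. \<alpha> j *\<^sub>C \<xi> j) = (\<Sum>j=1..n. \<alpha>' j *\<^sub>C \<xi> j)"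
    using s by blast
next
  fix w
  assume "\<exists>s' \<alpha>'. s' \<in> Domain T0 \<and>
      s + (\<Sum>j=1..n. \<alpha> j *\<^sub>C t j) = s' + (\<Sum>j=1..n. \<alpha>' j *\<^sub>C t j) \<and>
      w = (\<Sum>j=1..n. \<alpha>' j *\<^sub>C \<xi> j)"
  then obtain s' \<alpha>' where s': "s' \<in> Domain T0"
    and eq: "s + (\<Sum>j=1..n. \<alpha> j *\<^sub>C t j) = s' + (\<Sum>j=1..n. \<alpha>' j *\<^sub>C t j)"
    and w: "w = (\<Sum>j=1..n. \<alpha>' j *\<^sub>C \<xi> j)"
    by blast
  have "s - s' \<in> Domain T0"
  proof -
    from s s' obtain y y' where "(s, y) \<in> T0" "(s', y') \<in> T0" by blast
    then have "(s, y) - (s', y') \<in> T0"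
      using T0 complex_vector.subspace_diff unfolding linear_operator_def by blast
    then show ?thesis by auto
  qed
  moreover have "(\<Sum>j=1..n. (\<alpha>' j - \<alpha> j) *\<^sub>C t j) = s - s'"
    using eq by (simp add: complex_vector.scale_left_diff_distrib sum_subtractf algebra_simps)
  ultimately have "(\<Sum>j=1..n. (\<alpha>' j - \<alpha> j) *\<^sub>C t j) \<in> Domain T0"
    by simp
  then have "\<forall>j\<in>{1..n}. \<alpha>' j - \<alpha> j = 0"
    using t unfolding partial_GKN_def by (elim conjE allE impE) assumption+
  then show "w = (\<Sum>j=1..n. \<alpha> j *\<^sub>C \<xi> j)"
    unfolding w by (intro sum.cong) auto
qed

end

(* The graph of the extended operator is the complex span of the graph of T0, embedded with
   zero W-components, together with the n vectors ((t j, xi j), (T1 (t j), B (xi j))).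
   Its adjoint is therefore determined by testing against these generators: those from T0 say that
   the H-components lie in T1, the remaining n say that the W-component of the image is B a - Omega x.
   Symmetry, too, need only be checked on pairs of generators.  Closedness holds because a closed
   subspace stays closed when finitely many vectors are adjoined. *)

theory Submission
  imports Defs
begin

section \<open>Sesquilinearity and the norm\<close>

lemma cinner_add_right: "cinner x (y + z) = cinner x y + cinner x (z::'a::complex_inner)"
  by (metis cinner_add_left cinner_commute complex_cnj_add)

lemma cinner_scaleC_right: "cinner x (a *\<^sub>C y) = cnj a * cinner x (y::'a::complex_inner)"
  by (metis cinner_scaleC_left cinner_commute complex_cnj_mult)

lemma cinner_zero_left [simp]: "cinner 0 (x::'a::complex_inner) = 0"
  using cinner_add_left[of 0 0 x] by simp

lemma cinner_zero_right [simp]: "cinner (x::'a::complex_inner) 0 = 0"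
  using cinner_add_right[of x 0 0] by simp

lemma cinner_diff_right: "cinner x (y - z) = cinner x y - cinner x (z::'a::complex_inner)"
  using cinner_add_right[of x "y - z" z] by simp

lemma cinner_sum_left: "cinner (\<Sum>i\<in>A. f i) (x::'a::complex_inner) = (\<Sum>i\<in>A. cinner (f i) x)"
  by (induction A rule: infinite_finite_induct) (simp_all add: cinner_add_left)

lemma norm_scaleC: "norm (a *\<^sub>C x) = cmod a * norm (x::'a::complex_inner)"
proof -
  have "cinner (a *\<^sub>C x) (a *\<^sub>C x) = complex_of_real ((cmod a)\<^sup>2) * cinner x x"
    unfolding cinner_scaleC_left cinner_scaleC_right complex_norm_square
    by (simp only: mult.assoc mult.left_commute)
  then have "inner (a *\<^sub>C x) (a *\<^sub>C x) = (cmod a)\<^sup>2 * inner x x"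
    by (simp add: inner_eq_Re_cinner del: of_real_power)
  then show ?thesis
    by (simp add: norm_eq_sqrt_inner real_sqrt_mult)
qed

section \<open>Closedness and coordinates of finitely generated spans\<close>

lemma tendsto_scaleC_left:
  fixes x :: "'a::complex_inner"
  assumes "(f \<longlongrightarrow> a) F"
  shows "((\<lambda>k. f k *\<^sub>C x) \<longlongrightarrow> a *\<^sub>C x) F"
proof -
  have "((\<lambda>k. cmod (f k - a) * norm x) \<longlongrightarrow> 0) F"
    by (rule tendsto_mult_left_zero[OF tendsto_norm_zero[OF LIM_zero[OF assms]]])
  then have "((\<lambda>k. (f k - a) *\<^sub>C x) \<longlongrightarrow> 0) F"
    unfolding norm_scaleC[symmetric] by (rule tendsto_norm_zero_cancel)
  then have "((\<lambda>k. f k *\<^sub>C x - a *\<^sub>C x) \<longlongrightarrow> 0) F"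
    by (simp only: complex_vector.scale_left_diff_distrib)
  then show ?thesis
    by (rule LIM_zero_cancel)
qed

text \<open>If \<open>v\<close> lies outside the closed span of \<open>S\<close>, the coefficient of
  \<open>v\<close> is controlled by the norm of the vector. Along a convergent sequence the
  coefficients are therefore Cauchy and converge in the complex plane. Subtracting their multiples
  of \<open>v\<close> leaves a convergent sequence in the span of \<open>S\<close>, whose limit
  stays there.\<close>

lemma closed_span_insert:
  fixes v :: "'a::complex_inner"
  assumes closed: "closed (complex_vector.span S)"
  shows "closed (complex_vector.span (insert v S))"
proof (cases "v \<in> complex_vector.span S")
  case True
  then show ?thesis
    using closed by (simp add: complex_vector.span_redundant)
next
  case False
  let ?U = "complex_vector.span S"
  have "open (- ?U)" "v \<in> - ?U"
    using closed False by auto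
  then obtain e where e: "e > 0" "ball v e \<subseteq> - ?U"
    by (meson openE)
  \<comment> \<open>The \<open>v\<close>-coefficient depends continuously on the vector, as \<open>v\<close> has distance \<open>\<ge> e\<close> to the span.\<close>
  have coeff_bound: "cmod a * e \<le> norm y" if y: "y - a *\<^sub>C v \<in> ?U" for a y
  proof (cases "a = 0")
    case False
    \<comment> \<open>Dividing by \<open>- a\<close> turns the given vector into \<open>v\<close>
      minus a multiple of \<open>y\<close>. Being in the span, it avoids the ball around
      \<open>v\<close>, so that multiple of \<open>y\<close> has norm at least
      \<open>e\<close>.\<close>
    have "(- inverse a) *\<^sub>C (y - a *\<^sub>C v) \<in> ?U"
      using y by (rule complex_vector.span_scale)
    moreover have "(- inverse a) *\<^sub>C (y - a *\<^sub>C v) = v - inverse a *\<^sub>C y"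
      using False by (simp add: complex_vector.scale_right_diff_distrib)
    ultimately have "v - inverse a *\<^sub>C y \<in> ?U"
      by (rule subst[rotated])
    then have "v - inverse a *\<^sub>C y \<notin> ball v e"
      using e(2) by blast
    then have "e \<le> norm (inverse a *\<^sub>C y)"
      by (simp add: dist_norm)
    then have "cmod a * e \<le> cmod a * (inverse (cmod a) * norm y)"
      by (intro mult_left_mono) (simp_all add: norm_scaleC norm_inverse)
    also have "\<dots> = norm y"
      using False by simp
    finally show ?thesis .
  qed simp
  show ?thesis
    unfolding closed_sequential_limits
  proof (intro allI impI, elim conjE)
    fix y l
    assume mem: "\<forall>k. y k \<in> complex_vector.span (insert v S)" and lim: "y \<longlonglongrightarrow> l"
    obtain a where a: "y k - a k *\<^sub>C v \<in> ?U" for k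
      using choice[OF mem[unfolded complex_vector.span_breakdown_eq]] by blast
    have a_diff: "cmod (a k - a m) * e \<le> norm (y k - y m)" for k m
    proof (rule coeff_bound)
      have "y k - y m - (a k - a m) *\<^sub>C v = (y k - a k *\<^sub>C v) - (y m - a m *\<^sub>C v)"
        unfolding complex_vector.scale_left_diff_distrib by simp
      then show "y k - y m - (a k - a m) *\<^sub>C v \<in> ?U"
        by (simp only: complex_vector.span_diff a)
    qed
    have "Cauchy a"
      unfolding Cauchy_def
    proof (intro allI impI)
      fix r :: real
      assume "r > 0"
      then have "r * e > 0"
        using e by simp
      then obtain M where M: "\<forall>m\<ge>M. \<forall>k\<ge>M. dist (y m) (y k) < r * e"
        using LIMSEQ_imp_Cauchy[OF lim] unfolding Cauchy_def by blast
      have "dist (a m) (a k) < r" if "m \<ge> M" "k \<ge> M" for m k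
      proof -
        have "cmod (a m - a k) * e < r * e"
          using a_diff[of m k] M[rule_format, OF that] unfolding dist_norm by (rule order.strict_trans1)
        then show ?thesis
          using e by (simp add: dist_norm)
      qed
      then show "\<exists>M. \<forall>m\<ge>M. \<forall>k\<ge>M. dist (a m) (a k) < r"
        by blast
    qed
    then obtain L where L: "a \<longlonglongrightarrow> L"
      unfolding Cauchy_convergent_iff convergent_def by blast
    have "(\<lambda>k. y k - a k *\<^sub>C v) \<longlonglongrightarrow> l - L *\<^sub>C v"
      by (intro tendsto_diff lim tendsto_scaleC_left L)
    then have "l - L *\<^sub>C v \<in> ?U"
      by (rule closed_sequentially[OF closed a])
    then show "l \<in> complex_vector.span (insert v S)"
      unfolding complex_vector.span_breakdown_eq by (rule exI)
  qed
qed

lemma closed_span_finite_Un: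
  fixes S :: "'a::complex_inner set"
  assumes "finite A" and "closed (complex_vector.span S)"
  shows "closed (complex_vector.span (A \<union> S))"
  using assms by (induction A) (simp_all add: closed_span_insert)

text \<open>Coefficients are indexed by \<open>I\<close> rather than by the vectors themselves, so
  that repetitions in the family \<open>v\<close> do no harm.\<close>

lemma span_image_finite:
  fixes v :: "'i \<Rightarrow> 'a::complex_vector"
  assumes "finite I"
  shows "complex_vector.span (v ` I) = range (\<lambda>\<alpha>. \<Sum>i\<in>I. \<alpha> i *\<^sub>C v i)"
proof
  have sub: "complex_vector.subspace (range (\<lambda>\<alpha>. \<Sum>i\<in>I. \<alpha> i *\<^sub>C v i))"
    unfolding complex_vector.subspace_def
  proof (intro conjI ballI allI)
    show "0 \<in> range (\<lambda>\<alpha>. \<Sum>i\<in>I. \<alpha> i *\<^sub>C v i)"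
      by (rule range_eqI[where x = "\<lambda>_. 0"]) simp
  next
    fix x y
    assume "x \<in> range (\<lambda>\<alpha>. \<Sum>i\<in>I. \<alpha> i *\<^sub>C v i)" "y \<in> range (\<lambda>\<alpha>. \<Sum>i\<in>I. \<alpha> i *\<^sub>C v i)"
    then obtain \<alpha> \<beta> where "x = (\<Sum>i\<in>I. \<alpha> i *\<^sub>C v i)" "y = (\<Sum>i\<in>I. \<beta> i *\<^sub>C v i)"
      by blast
    then show "x + y \<in> range (\<lambda>\<alpha>. \<Sum>i\<in>I. \<alpha> i *\<^sub>C v i)"
      by (intro range_eqI[where x = "\<lambda>i. \<alpha> i + \<beta> i"]) (simp add: scaleC_add_left sum.distrib)
  next
    fix c x
    assume "x \<in> range (\<lambda>\<alpha>. \<Sum>i\<in>I. \<alpha> i *\<^sub>C v i)"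
    then obtain \<alpha> where "x = (\<Sum>i\<in>I. \<alpha> i *\<^sub>C v i)"
      by blast
    then show "c *\<^sub>C x \<in> range (\<lambda>\<alpha>. \<Sum>i\<in>I. \<alpha> i *\<^sub>C v i)"
      by (intro range_eqI[where x = "\<lambda>i. c * \<alpha> i"])
        (simp add: complex_vector.scale_sum_right)
  qed
  have "v ` I \<subseteq> range (\<lambda>\<alpha>. \<Sum>i\<in>I. \<alpha> i *\<^sub>C v i)"
  proof
    fix x
    assume "x \<in> v ` I"
    then obtain i where i: "i \<in> I" "x = v i"
      by blast
    have "(\<Sum>k\<in>I. (if k = i then 1 else 0) *\<^sub>C v k) = (\<Sum>k\<in>I. if k = i then v k else 0)"
      by (intro sum.cong) auto
    also have "\<dots> = v i"
      using i assms by simp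
    finally show "x \<in> range (\<lambda>\<alpha>. \<Sum>i\<in>I. \<alpha> i *\<^sub>C v i)"
      using i by (intro range_eqI[where x = "\<lambda>k. if k = i then 1 else 0"]) simp
  qed
  then show "complex_vector.span (v ` I) \<subseteq> range (\<lambda>\<alpha>. \<Sum>i\<in>I. \<alpha> i *\<^sub>C v i)"
    using sub by (rule complex_vector.span_minimal)
next
  show "range (\<lambda>\<alpha>. \<Sum>i\<in>I. \<alpha> i *\<^sub>C v i) \<subseteq> complex_vector.span (v ` I)"
    by (intro image_subsetI complex_vector.span_sum complex_vector.span_scale
        complex_vector.span_base imageI)
qed

section \<open>Operators as graphs and their adjoints\<close>

lemma op_app_eq: "single_valued T \<Longrightarrow> (x, y) \<in> T \<Longrightarrow> T \<bullet>\<^sub>o x = y"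
  unfolding op_app_def by (auto dest: single_valuedD)

lemma op_app_mem: "single_valued T \<Longrightarrow> x \<in> Domain T \<Longrightarrow> (x, T \<bullet>\<^sub>o x) \<in> T"
  by (auto simp: op_app_eq)

text \<open>Each pair in \<open>T\<close> imposes a condition that is conjugate-linear in the tested
  pair. This holds for every relation \<open>T\<close>, so that adjoints of mere generating sets are
  subspaces too.\<close>

lemma subspace_op_adjoint: "complex_vector.subspace (op_adjoint T)"
  unfolding complex_vector.subspace_def op_adjoint_def
  by (auto simp: cinner_add_right cinner_scaleC_right scaleC_prod_def case_prod_beta)

text \<open>For a fixed candidate pair, the graph points that satisfy the adjoint equation form a
  subspace. Once it contains \<open>S\<close>, it contains the span.\<close>

lemma op_adjoint_span: "op_adjoint (complex_vector.span S) = op_adjoint S"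
proof
  show "op_adjoint (complex_vector.span S) \<subseteq> op_adjoint S"
    unfolding op_adjoint_def using complex_vector.span_superset[of S] by fast
  show "op_adjoint S \<subseteq> op_adjoint (complex_vector.span S)"
  proof
    fix p
    assume p: "p \<in> op_adjoint S"
    have "complex_vector.subspace {q. cinner (snd q) (fst p) = cinner (fst q) (snd p)}"
      unfolding complex_vector.subspace_def
      by (simp add: cinner_add_left cinner_scaleC_left scaleC_prod_def)
    moreover have "S \<subseteq> {q. cinner (snd q) (fst p) = cinner (fst q) (snd p)}"
      using p unfolding op_adjoint_def by fastforce
    ultimately have "complex_vector.span S \<subseteq> {q. cinner (snd q) (fst p) = cinner (fst q) (snd p)}"
      by (simp add: complex_vector.span_minimal)
    then show "p \<in> op_adjoint (complex_vector.span S)"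
      unfolding op_adjoint_def by (auto simp: case_prod_beta)
  qed
qed

lemma op_adjoint_Un: "op_adjoint (S \<union> T) = op_adjoint S \<inter> op_adjoint T"
  unfolding op_adjoint_def by auto

text \<open>Two images of the same vector differ by a vector orthogonal to the domain of
  \<open>T\<close>. Orthogonality to a fixed vector is a closed condition, so by density the
  difference is orthogonal to itself. The real inner product suffices for this argument.\<close>

lemma single_valued_op_adjoint:
  assumes "densely_defined T"
  shows "single_valued (op_adjoint T)"
proof (rule single_valuedI)
  fix y z z'
  assume "(y, z) \<in> op_adjoint T" "(y, z') \<in> op_adjoint T"
  then have "Domain T \<subseteq> {x. inner x (z - z') = 0}"
    unfolding op_adjoint_def by (fastforce simp: inner_eq_Re_cinner cinner_diff_right)
  moreover have "closed {x. inner x (z - z') = 0}"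
    by (intro closed_Collect_eq continuous_intros)
  ultimately have "closure (Domain T) \<subseteq> {x. inner x (z - z') = 0}"
    by (rule closure_minimal)
  then have "inner (z - z') (z - z') = 0"
    using assms unfolding densely_defined_def by blast
  then show "z = z'"
    by simp
qed

section \<open>Coordinates in W and the map \<Omega>\<close>

text \<open>The vectors orthogonal to \<open>a - b\<close> form a subspace; if it contains the
  basis, it contains \<open>a - b\<close> itself. The basis vectors stand in the first argument
  because graph points do so in the adjoint equation.\<close>

lemma orthonormal_basis_eqI:
  fixes a b :: "'w::complex_inner"
  assumes basis: "orthonormal_basis n \<xi>" and eq: "\<And>j. j \<in> {1..n} \<Longrightarrow> cinner (\<xi> j) a = cinner (\<xi> j) b"
  shows "a = b"
proof -
  have "complex_vector.subspace {w. cinner w (a - b) = 0}"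
    unfolding complex_vector.subspace_def by (simp add: cinner_add_left cinner_scaleC_left)
  moreover have "\<xi> ` {1..n} \<subseteq> {w. cinner w (a - b) = 0}"
    using eq by (auto simp: cinner_diff_right)
  ultimately have "complex_vector.span (\<xi> ` {1..n}) \<subseteq> {w. cinner w (a - b) = 0}"
    by (simp add: complex_vector.span_minimal)
  then have "cinner (a - b) (a - b) = 0"
    using basis unfolding orthonormal_basis_def by blast
  then have "inner (a - b) (a - b) = 0"
    by (simp add: inner_eq_Re_cinner)
  then show ?thesis
    by simp
qed

lemma symp_commute: "symp T x y = - cnj (symp T y x)"
  unfolding symp_def
  by (simp add: cinner_commute[of "T \<bullet>\<^sub>o x" y] cinner_commute[of x "T \<bullet>\<^sub>o y"])

text \<open>Orthonormality singles out \<open>symp T x (t j)\<close> when \<Omega> stands in the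
  first slot. Exchanging the slots conjugates it, and the skew-Hermitian symmetry of
  \<open>symp\<close> turns the conjugate into the negative with swapped arguments.\<close>

lemma cinner_\<Omega>:
  fixes \<xi> :: "nat \<Rightarrow> 'w::complex_inner"
  assumes basis: "orthonormal_basis n \<xi>" and j: "j \<in> {1..n}"
  shows "cinner (\<xi> j) (\<Omega> T n t \<xi> x) = - symp T (t j) x"
proof -
  have "cinner (\<Omega> T n t \<xi> x) (\<xi> j) = (\<Sum>i=1..n. symp T x (t i) * cinner (\<xi> i) (\<xi> j))"
    unfolding \<Omega>_def by (simp add: cinner_sum_left cinner_scaleC_left)
  also have "\<dots> = (\<Sum>i=1..n. if i = j then symp T x (t i) else 0)"
    using basis j unfolding orthonormal_basis_def by (intro sum.cong) auto
  also have "\<dots> = symp T x (t j)"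
    using j by simp
  finally show ?thesis
    by (metis cinner_commute symp_commute minus_minus)
qed

section \<open>Generators of the extended operator\<close>

definition zero_ext ::
    "('h::complex_inner \<times> 'h) set \<Rightarrow> (('h \<times> 'w::complex_inner) \<times> ('h \<times> 'w)) set" where
  "zero_ext T = {((s, 0), (w, 0)) | s w. (s, w) \<in> T}"

text \<open>This is the point of the extended graph above \<open>t j\<close>: for a partial GKN set,
  \<Psi> sends \<open>t j\<close> to \<open>\<xi> j\<close>.\<close>

definition GKN_generator ::
    "('h::complex_inner \<times> 'h) set \<Rightarrow> (nat \<Rightarrow> 'h) \<Rightarrow> (nat \<Rightarrow> 'w::complex_inner) \<Rightarrow> ('w \<Rightarrow> 'w) \<Rightarrow>
      nat \<Rightarrow> ('h \<times> 'w) \<times> ('h \<times> 'w)" where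
  "GKN_generator T1 t \<xi> B j = ((t j, \<xi> j), (T1 \<bullet>\<^sub>o t j, B (\<xi> j)))"

text \<open>The map regroups the four coordinates into an H-pair and a W-pair. It is continuous, so
  closedness can be pulled back from \<open>T \<times> {0}\<close>.\<close>

lemma zero_ext_eq_vimage:
  "zero_ext T = (\<lambda>p. ((fst (fst p), fst (snd p)), (snd (fst p), snd (snd p)))) -` (T \<times> {0})"
  unfolding zero_ext_def by (auto simp: zero_prod_def)

lemma closed_zero_ext: "closed T \<Longrightarrow> closed (zero_ext T)"
  unfolding zero_ext_eq_vimage
  by (intro continuous_closed_vimage closed_Times closed_singleton continuous_intros)

lemma subspace_zero_ext:
  assumes "complex_vector.subspace T"
  shows "complex_vector.subspace
    (zero_ext T :: (('h::complex_inner \<times> 'w::complex_inner) \<times> ('h \<times> 'w)) set)"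
    (is "complex_vector.subspace ?E")
proof -
  have mem: "p \<in> ?E \<longleftrightarrow>
      (fst (fst p), fst (snd p)) \<in> T \<and> snd (fst p) = 0 \<and> snd (snd p) = 0" for p
    unfolding zero_ext_def by (auto simp: prod_eq_iff)
  show ?thesis
  proof (rule complex_vector.subspaceI)
    show "0 \<in> ?E"
      using complex_vector.subspace_0[OF assms] by (simp add: mem zero_prod_def)
  next
    fix p q
    assume "p \<in> ?E" "q \<in> ?E"
    then show "p + q \<in> ?E"
      using complex_vector.subspace_add[OF assms, of "(fst (fst p), fst (snd p))"
          "(fst (fst q), fst (snd q))"]
      by (simp add: mem)
  next
    fix c p
    assume "p \<in> ?E"
    then show "c *\<^sub>C p \<in> ?E"
      using complex_vector.subspace_scale[OF assms, of "(fst (fst p), fst (snd p))" c]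
      by (simp add: mem scaleC_prod_def)
  qed
qed

lemma span_zero_ext:
  "complex_vector.subspace T \<Longrightarrow> complex_vector.span (zero_ext T) = zero_ext T"
  using subspace_zero_ext complex_vector.span_eq_iff by blast

lemma sum_GKN_generator:
  assumes "Vector_Spaces.linear scaleC scaleC B"
  shows "(\<Sum>j=1..n. \<alpha> j *\<^sub>C GKN_generator T1 t \<xi> B j) =
    ((\<Sum>j=1..n. \<alpha> j *\<^sub>C t j, \<Sum>j=1..n. \<alpha> j *\<^sub>C \<xi> j),
     (\<Sum>j=1..n. \<alpha> j *\<^sub>C (T1 \<bullet>\<^sub>o t j), B (\<Sum>j=1..n. \<alpha> j *\<^sub>C \<xi> j)))"
proof -
  interpret B: Vector_Spaces.linear scaleC scaleC B
    by fact
  show ?thesis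
    by (simp add: GKN_generator_def prod_eq_iff fst_sum snd_sum scaleC_prod_def B.sum B.scale)
qed

text \<open>Write a vector of \<open>\<Delta>\<^sub>0\<close> as \<open>s\<close> plus a combination
  of the \<open>t j\<close>. Linearity of the extension \<open>T1\<close> gives its image, and
  \<open>\<Psi>_eq\<close> gives its W-component with the same coefficients. The graph point is thus
  the same combination of the generators plus the zero-extended graph point of
  \<open>s\<close>.\<close>

lemma That0_eq_span:
  fixes \<xi> :: "nat \<Rightarrow> 'w::complex_inner"
  assumes T0: "linear_operator T0" and T1: "linear_operator T1" and ext: "T0 \<subseteq> T1"
    and t: "partial_GKN T0 T1 n t" and B: "Vector_Spaces.linear scaleC scaleC B"
  shows "That0 T0 T1 n t \<xi> B =
    complex_vector.span (GKN_generator T1 t \<xi> B ` {1..n} \<union> zero_ext T0)"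
proof -
  let ?g = "GKN_generator T1 t \<xi> B"
  have sub1: "complex_vector.subspace T1" and sv1: "single_valued T1"
    using T1 unfolding linear_operator_def by auto
  have T1_app: "T1 \<bullet>\<^sub>o (s + (\<Sum>j=1..n. \<alpha> j *\<^sub>C t j)) = w + (\<Sum>j=1..n. \<alpha> j *\<^sub>C (T1 \<bullet>\<^sub>o t j))"
    if "(s, w) \<in> T0" for s w \<alpha>
  proof (rule op_app_eq[OF sv1])
    have "(t j, T1 \<bullet>\<^sub>o t j) \<in> T1" if "j \<in> {1..n}" for j
      using t that op_app_mem[OF sv1] unfolding partial_GKN_def by blast
    then have "(s, w) + (\<Sum>j=1..n. \<alpha> j *\<^sub>C (t j, T1 \<bullet>\<^sub>o t j)) \<in> T1"
      using sub1 ext that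
      by (intro complex_vector.subspace_add complex_vector.subspace_sum
          complex_vector.subspace_scale) auto
    moreover have "(s, w) + (\<Sum>j=1..n. \<alpha> j *\<^sub>C (t j, T1 \<bullet>\<^sub>o t j)) =
        (s + (\<Sum>j=1..n. \<alpha> j *\<^sub>C t j), w + (\<Sum>j=1..n. \<alpha> j *\<^sub>C (T1 \<bullet>\<^sub>o t j)))"
      by (simp add: prod_eq_iff fst_sum snd_sum scaleC_prod_def)
    ultimately show "(s + (\<Sum>j=1..n. \<alpha> j *\<^sub>C t j), w + (\<Sum>j=1..n. \<alpha> j *\<^sub>C (T1 \<bullet>\<^sub>o t j))) \<in> T1"
      by simp
  qed
  have "That0 T0 T1 n t \<xi> B =
      {((x, \<Psi> T0 n t \<xi> x), (T1 \<bullet>\<^sub>o x, B (\<Psi> T0 n t \<xi> x))) | x. x \<in> \<Delta>\<^sub>0 T0 n t}"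
    unfolding That0_def op_on_def by auto
  \<comment> \<open>The additional witness \<open>w\<close> records the image of \<open>s\<close>,
    which becomes a coordinate of the graph point.\<close>
  also have "\<Delta>\<^sub>0 T0 n t = {s + (\<Sum>j=1..n. \<alpha> j *\<^sub>C t j) | s w \<alpha>. (s, w) \<in> T0}"
    unfolding \<Delta>\<^sub>0_def by (auto simp: span_image_finite)
  also have "{((x, \<Psi> T0 n t \<xi> x), (T1 \<bullet>\<^sub>o x, B (\<Psi> T0 n t \<xi> x))) | x.
        x \<in> {s + (\<Sum>j=1..n. \<alpha> j *\<^sub>C t j) | s w \<alpha>. (s, w) \<in> T0}} =
      {(\<Sum>j=1..n. \<alpha> j *\<^sub>C ?g j) + ((s, 0), (w, 0)) | s w \<alpha>. (s, w) \<in> T0}" (is "?L = ?R")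
  proof -
    have point: "((x, \<Psi> T0 n t \<xi> x), (T1 \<bullet>\<^sub>o x, B (\<Psi> T0 n t \<xi> x))) =
        (\<Sum>j=1..n. \<alpha> j *\<^sub>C ?g j) + ((s, 0), (w, 0))"
      if "(s, w) \<in> T0" "x = s + (\<Sum>j=1..n. \<alpha> j *\<^sub>C t j)" for s w \<alpha> x
    proof -
      have "\<Psi> T0 n t \<xi> x = (\<Sum>j=1..n. \<alpha> j *\<^sub>C \<xi> j)"
        using that \<Psi>_eq[OF T0 t] by blast
      then show ?thesis
        \<comment> \<open>Keeping the lower summation bound as \<open>1\<close> lets the sums match
          the left-hand sides of the rewrite rules.\<close>
        using that by (simp add: sum_GKN_generator[OF B] T1_app add.commute del: One_nat_def)
    qed
    show ?thesis
    proof (intro subset_antisym subsetI)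
      fix p assume "p \<in> ?L"
      then show "p \<in> ?R" using point by blast
    next
      fix p assume "p \<in> ?R"
      then obtain s w \<alpha> where "(s, w) \<in> T0" "p = (\<Sum>j=1..n. \<alpha> j *\<^sub>C ?g j) + ((s, 0), (w, 0))"
        by blast
      then show "p \<in> ?L" using point[OF _ refl, symmetric] by blast
    qed
  qed
  also have "\<dots> = complex_vector.span (?g ` {1..n} \<union> zero_ext T0)"
  proof -
    have "complex_vector.subspace T0"
      using T0 unfolding linear_operator_def by blast
    then show ?thesis
      unfolding complex_vector.span_Un span_zero_ext[OF \<open>complex_vector.subspace T0\<close>]
        span_image_finite[OF finite_atLeastAtMost]
      unfolding zero_ext_def by blast
  qed
  finally show ?thesis .
qed

section \<open>Adjoint, closedness and symmetry of the extended operator\<close>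

text \<open>The zero W-components annihilate the terms with \<open>b\<close> and \<open>c\<close>,
  so these stay free.\<close>

lemma op_adjoint_zero_ext:
  "((y, b), (z, c)) \<in> op_adjoint (zero_ext T) \<longleftrightarrow> (y, z) \<in> op_adjoint T"
  unfolding op_adjoint_def zero_ext_def by (fastforce simp: cinner_prod_def)

text \<open>After \<open>B\<close> is moved across by self-adjointness, the equation for generator
  \<open>j\<close> prescribes the inner product of \<open>\<xi> j\<close> with \<open>c\<close>: it
  is that with \<open>B b\<close> plus \<open>symp T (t j) y\<close>. By
  \<open>cinner_\<Omega>\<close> this is the inner product with
  \<open>B b - \<Omega> T n t \<xi> y\<close>, and the basis determines \<open>c\<close>.\<close>

lemma op_adjoint_GKN_generator:
  fixes \<xi> :: "nat \<Rightarrow> 'w::complex_inner"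
  assumes basis: "orthonormal_basis n \<xi>" and B: "selfadjoint_map B"
  shows "((y, b), (T \<bullet>\<^sub>o y, c)) \<in> op_adjoint (GKN_generator T t \<xi> B ` {1..n}) \<longleftrightarrow>
    c = B b - \<Omega> T n t \<xi> y"
proof -
  have "((y, b), (T \<bullet>\<^sub>o y, c)) \<in> op_adjoint (GKN_generator T t \<xi> B ` {1..n}) \<longleftrightarrow>
      (\<forall>j\<in>{1..n}. cinner (T \<bullet>\<^sub>o t j) y + cinner (B (\<xi> j)) b =
        cinner (t j) (T \<bullet>\<^sub>o y) + cinner (\<xi> j) c)"
    unfolding op_adjoint_def GKN_generator_def by (simp add: cinner_prod_def)
  also have "\<dots> \<longleftrightarrow> (\<forall>j\<in>{1..n}. cinner (\<xi> j) c = cinner (\<xi> j) (B b - \<Omega> T n t \<xi> y))"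
  proof (rule ball_cong[OF refl])
    fix j
    assume "j \<in> {1..n}"
    moreover have "cinner (B (\<xi> j)) b = cinner (\<xi> j) (B b)"
      using B unfolding selfadjoint_map_def by blast
    ultimately show "cinner (T \<bullet>\<^sub>o t j) y + cinner (B (\<xi> j)) b =
        cinner (t j) (T \<bullet>\<^sub>o y) + cinner (\<xi> j) c \<longleftrightarrow>
        cinner (\<xi> j) c = cinner (\<xi> j) (B b - \<Omega> T n t \<xi> y)"
      by (auto simp: cinner_diff_right cinner_\<Omega>[OF basis] symp_def algebra_simps)
  qed
  also have "\<dots> \<longleftrightarrow> c = B b - \<Omega> T n t \<xi> y"
    using orthonormal_basis_eqI[OF basis] by blast
  finally show ?thesis .
qed

lemma symmetric_operator_subset_op_adjoint:
  assumes "symmetric_operator T"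
  shows "T \<subseteq> op_adjoint T"
proof -
  have "cinner w y = cinner x z" if "(y, z) \<in> T" "(x, w) \<in> T" for x y z w
    using assms that op_app_eq[of T] unfolding symmetric_operator_def linear_operator_def
    by (metis DomainI)
  then show ?thesis
    unfolding op_adjoint_def by blast
qed

theorem theorem4p3:
  fixes T\<^sub>0 T\<^sub>1 :: "('h::complex_hilbert \<times> 'h) set"
    and \<xi> :: "nat \<Rightarrow> 'w::complex_inner"
    and t :: "nat \<Rightarrow> 'h"
    and B :: "'w \<Rightarrow> 'w"
    and d n :: nat
  assumes "symmetric_operator T\<^sub>0" and "closed T\<^sub>0"
    and "equal_finite_deficiency T\<^sub>0 d" and "d \<ge> 1"
    and "T\<^sub>1 = op_adjoint T\<^sub>0"
    and "finite_cdim (UNIV :: 'w set)"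
    and "n = complex_vector.dim (UNIV :: 'w set)" and "n \<le> d"
    and "orthonormal_basis n \<xi>"
    and "partial_GKN T\<^sub>0 T\<^sub>1 n t"
    and "selfadjoint_map B"
  shows "That0 T\<^sub>0 T\<^sub>1 n t \<xi> B = closure (That0 T\<^sub>0 T\<^sub>1 n t \<xi> B)
    \<and> closure (That0 T\<^sub>0 T\<^sub>1 n t \<xi> B) \<subseteq> op_adjoint (That0 T\<^sub>0 T\<^sub>1 n t \<xi> B)
    \<and> op_adjoint (That0 T\<^sub>0 T\<^sub>1 n t \<xi> B) = That1 T\<^sub>1 n t \<xi> B"
proof -
  note t = \<open>partial_GKN T\<^sub>0 T\<^sub>1 n t\<close> and T1 = \<open>T\<^sub>1 = op_adjoint T\<^sub>0\<close>
  let ?G = "GKN_generator T\<^sub>1 t \<xi> B ` {1..n}"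
  let ?E = "zero_ext T\<^sub>0 :: (('h \<times> 'w) \<times> ('h \<times> 'w)) set"
  have lin0: "linear_operator T\<^sub>0" and dense: "densely_defined T\<^sub>0"
    using assms(1) unfolding symmetric_operator_def by auto
  have sv1: "single_valued T\<^sub>1"
    using dense single_valued_op_adjoint T1 by blast
  have lin1: "linear_operator T\<^sub>1"
    using sv1 subspace_op_adjoint T1 unfolding linear_operator_def by blast
  have ext: "T\<^sub>0 \<subseteq> T\<^sub>1"
    using assms(1) T1 symmetric_operator_subset_op_adjoint by blast
  have That0: "That0 T\<^sub>0 T\<^sub>1 n t \<xi> B = complex_vector.span (?G \<union> ?E)"
    using That0_eq_span[OF lin0 lin1 ext t] assms(11) unfolding selfadjoint_map_def by blast
  have adj: "op_adjoint (That0 T\<^sub>0 T\<^sub>1 n t \<xi> B) = op_adjoint ?G \<inter> op_adjoint ?E"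
    by (simp add: That0 op_adjoint_span op_adjoint_Un)
  have mem_adj: "((y, b), (z, c)) \<in> op_adjoint ?G \<inter> op_adjoint ?E \<longleftrightarrow>
      (y, z) \<in> T\<^sub>1 \<and> c = B b - \<Omega> T\<^sub>1 n t \<xi> y" for y b z c
  \<comment> \<open>The criterion for the GKN generators mentions
    \<open>T\<^sub>1 \<bullet>\<^sub>o y\<close>, which can be replaced by \<open>z\<close> only
    when the pair lies in \<open>T\<^sub>1\<close>. Otherwise the zero-extended generators already
    exclude the pair.\<close>
  proof (cases "(y, z) \<in> T\<^sub>1")
    case True
    then have "T\<^sub>1 \<bullet>\<^sub>o y = z"
      by (rule op_app_eq[OF sv1])
    then show ?thesis
      using True op_adjoint_GKN_generator[OF assms(9,11), of y b "T\<^sub>1" c t]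
      unfolding Int_iff op_adjoint_zero_ext T1[symmetric] by blast
  next
    case False
    then show ?thesis
      unfolding Int_iff op_adjoint_zero_ext T1[symmetric] by blast
  qed

  \<comment> \<open>The zero extension is its own span and inherits closedness from
    \<open>T\<^sub>0\<close>; only the finitely many vectors of \<open>?G\<close> remain to be
    adjoined.\<close>
  have "closed (complex_vector.span ?E)"
    using lin0 closed_zero_ext[OF assms(2)] span_zero_ext unfolding linear_operator_def by metis
  then have "closed (That0 T\<^sub>0 T\<^sub>1 n t \<xi> B)"
    unfolding That0 by (simp add: closed_span_finite_Un)
  moreover have "That0 T\<^sub>0 T\<^sub>1 n t \<xi> B \<subseteq> op_adjoint (That0 T\<^sub>0 T\<^sub>1 n t \<xi> B)"
  proof -
    have "?E \<subseteq> op_adjoint ?G \<inter> op_adjoint ?E"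
    proof
      fix p
      assume "p \<in> ?E"
      then obtain s w where p: "p = ((s, 0), (w, 0))" and sw: "(s, w) \<in> T\<^sub>0"
        unfolding zero_ext_def by blast
      have app: "T\<^sub>1 \<bullet>\<^sub>o s = w"
        using sw ext op_app_eq[OF sv1] by blast
      \<comment> \<open>Since \<open>T\<^sub>1\<close> sends \<open>s\<close> to \<open>w\<close>,
        this is the defining equation of the adjoint for \<open>t j\<close>, tested on the pair
        \<open>(s, w)\<close> of \<open>T\<^sub>0\<close>.\<close>
      have "symp T\<^sub>1 s (t j) = 0" if "j \<in> {1..n}" for j
      proof -
        have "(t j, T\<^sub>1 \<bullet>\<^sub>o t j) \<in> op_adjoint T\<^sub>0"
          using t that op_app_mem[OF sv1] T1 unfolding partial_GKN_def by blast
        then show ?thesis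
          using sw app unfolding symp_def op_adjoint_def by auto
      qed
      then have "\<Omega> T\<^sub>1 n t \<xi> s = 0"
        unfolding \<Omega>_def by simp
      moreover have "B 0 = 0"
      proof -
        interpret B: Vector_Spaces.linear scaleC scaleC B
          using assms(11) unfolding selfadjoint_map_def by blast
        show ?thesis
          by (rule B.zero)
      qed
      ultimately show "p \<in> op_adjoint ?G \<inter> op_adjoint ?E"
        unfolding p mem_adj using sw ext by auto
    qed
    moreover have "?G \<subseteq> op_adjoint ?G \<inter> op_adjoint ?E"
    proof
      fix p
      assume "p \<in> ?G"
      then obtain i where i: "i \<in> {1..n}" and p: "p = ((t i, \<xi> i), (T\<^sub>1 \<bullet>\<^sub>o t i, B (\<xi> i)))"
        unfolding GKN_generator_def by blast
      \<comment> \<open>The mutual vanishing of \<open>symp\<close> on the partial GKN set enters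
        here: it removes the \<Omega>-term and leaves \<open>B (\<xi> i)\<close>, as
        required.\<close>
      have "\<Omega> T\<^sub>1 n t \<xi> (t i) = 0"
        using t i unfolding \<Omega>_def partial_GKN_def by simp
      moreover have "(t i, T\<^sub>1 \<bullet>\<^sub>o t i) \<in> T\<^sub>1"
        using t i op_app_mem[OF sv1] unfolding partial_GKN_def by blast
      ultimately show "p \<in> op_adjoint ?G \<inter> op_adjoint ?E"
        unfolding p mem_adj by simp
    qed
    ultimately have "?G \<union> ?E \<subseteq> op_adjoint (That0 T\<^sub>0 T\<^sub>1 n t \<xi> B)"
      unfolding adj by (rule Un_least[rotated])
    then have "complex_vector.span (?G \<union> ?E) \<subseteq> op_adjoint (That0 T\<^sub>0 T\<^sub>1 n t \<xi> B)"
      by (rule complex_vector.span_minimal) (rule subspace_op_adjoint)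
    then show ?thesis
      unfolding That0[symmetric] .
  qed
  moreover have "op_adjoint (That0 T\<^sub>0 T\<^sub>1 n t \<xi> B) = That1 T\<^sub>1 n t \<xi> B"
  proof -
    have "((y, b), (z, c)) \<in> That1 T\<^sub>1 n t \<xi> B \<longleftrightarrow> (y, z) \<in> T\<^sub>1 \<and> c = B b - \<Omega> T\<^sub>1 n t \<xi> y"
      for y b z c
      unfolding That1_def op_on_def using op_app_eq[OF sv1] op_app_mem[OF sv1] by auto
    then show ?thesis
      using mem_adj unfolding adj by (intro set_eqI) (simp only: split_paired_all)
  qed
  ultimately show ?thesis
    by (simp add: closure_closed)
qed

end
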